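(* Let $p\ge 2$ be an integer with prime factorization $p=\prod_{i=1}^{\rho}p_i^{a_i}$ and let $D_p=\{\prod_{i=1}^{\rho}p_i^{c_i}: 0\le c_i\le a_i\}$ be its set of divisors. The number of non-primary MSS-sequences of length $p$ of the form $RL^q\,S\,C$ with $q\ge 1$, $m\ge 0$, $S\in\mathrm{S}(m,q-1)$ (all such $q$ and $m$ with $q+m+2=p$ being considered together) is $|D_p|-2$.
   Context: An admissible sequence is a finite word $A_1A_2\cdots A_p$ with $A_i\in\{R,L\}$ for $i<p$ and $A_p=C$. Put $L<C<R$. The parity-lexicographic order on admissible sequences: if $P^1\neq P^2$ and $i$ is the first index where they differ, then, if the common prefix of length $i-1$ contains an even number of $R$s, $P^1<P^2$ iff $A^1_i<A^2_i$; if it contains an odd number of $R$s, $P^1<P^2$ iff $A^2_i<A^1_i$. The right shifts of $P$ are $\sigma^k(P)=A_{k+1}\cdots A_p$; $P$ is shift maximal if it is greater than or equal to each of its right shifts. The MSS-sequences (for unimodal round-top concave maps) are exactly the shift maximal admissible sequences (results of Beyer, Mauldin and Stein); this is taken here as the meaning of "MSS-sequence". $\mathrm{S}(m,h)$ is the set of words in $R,L$ of length $m$ that start with $R$ and contain at most $h$ consecutive $L$s; for $m=0$ only the empty word is meant. Composition (Derrida–Gervois–Pomeau): for $O_h=x_1\cdots x_{h-1}C$ and $O_s=y_1\cdots y_{s-1}C$ with $x_i,y_j\in\{R,L\}$, put $Q=x_1\cdots x_{h-1}$. If $O_h$ contains an even number of $R$s, $O_h*O_s=Qy_1Qy_2\cdots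 y_{s-1}QC$; if it contains an odd number of $R$s, $O_h*O_s=Q\overline{y_1}Q\overline{y_2}\cdots\overline{y_{s-1}}QC$, where $\overline R=L$, $\overline L=R$. An MSS-sequence is non-primary if it equals $O_h*O_s$ for some MSS-sequences $O_h,O_s$ of length at least $2$, and primary otherwise. *)

theory Defs
  imports "HOL-Library.Sublist" "HOL-Computational_Algebra.Primes"
begin

datatype symb = L | C | R

fun symb_rank :: "symb \<Rightarrow> nat" where
  "symb_rank L = 0"
| "symb_rank C = 1"
| "symb_rank R = 2"

instantiation symb :: linorder
begin

definition less_eq_symb :: "symb \<Rightarrow> symb \<Rightarrow> bool" where
  "x \<le> y \<longleftrightarrow> symb_rank x \<le> symb_rank y"

definition less_symb :: "symb \<Rightarrow> symb \<Rightarrow> bool" where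
  "x < y \<longleftrightarrow> symb_rank x < symb_rank y"

instance
proof
  fix x y :: symb
  assume "x \<le> y" and "y \<le> x"
  then show "x = y"
    by (cases x; cases y) (simp_all add: less_eq_symb_def)
qed (auto simp: less_eq_symb_def less_symb_def)

end

lemma symb_order: "L < C" "C < R"
  by (simp_all add: less_symb_def)

definition admissible :: "symb list \<Rightarrow> bool" where
  "admissible P \<longleftrightarrow> P \<noteq> [] \<and> set (butlast P) \<subseteq> {R, L} \<and> last P = C"

text \<open>
  In an admissible word the letter C occurs only at the end, so two distinct admissible words
  always differ at some index below both lengths; below, that first index is i (counted from 0),
  and the common prefix is the one of length i.
\<close>

definition parity_lex_less :: "symb list \<Rightarrow> symb list \<Rightarrow> bool" where
  "parity_lex_less P P' \<longleftrightarrow>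
     (\<exists>i. i < length P \<and> i < length P' \<and> take i P = take i P' \<and> P ! i \<noteq> P' ! i \<and>
          (if even (count_list (take i P) R) then P ! i < P' ! i else P' ! i < P ! i))"

definition shift_maximal :: "symb list \<Rightarrow> bool" where
  "shift_maximal P \<longleftrightarrow> (\<forall>k < length P. drop k P = P \<or> parity_lex_less (drop k P) P)"

definition MSS_sequence :: "symb list \<Rightarrow> bool" where
  "MSS_sequence P \<longleftrightarrow> admissible P \<and> shift_maximal P"

text \<open>The set S(m, h); the condition on the first letter is void exactly for m = 0.\<close>

definition S_words :: "nat \<Rightarrow> nat \<Rightarrow> symb list set" where
  "S_words m h = {w. set w \<subseteq> {R, L} \<and> length w = m \<and> (w \<noteq> [] \<longrightarrow> hd w = R) \<and>
                     (\<forall>k. sublist (replicate k L) w \<longrightarrow> k \<le> h)}"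

fun symb_bar :: "symb \<Rightarrow> symb" where
  "symb_bar R = L"
| "symb_bar L = R"
| "symb_bar C = C" \<comment> \<open>never used: the bar is only applied to letters before the final C\<close>

definition DGP_compose :: "symb list \<Rightarrow> symb list \<Rightarrow> symb list" where
  "DGP_compose P P' =
     (let Q = butlast P;
          f = (if even (count_list P R) then id else symb_bar)
      in concat (map (\<lambda>y. Q @ [f y]) (butlast P')) @ Q @ [C])"

definition non_primary :: "symb list \<Rightarrow> bool" where
  "non_primary P \<longleftrightarrow> MSS_sequence P \<and>
     (\<exists>A B. MSS_sequence A \<and> MSS_sequence B \<and> length A \<ge> 2 \<and> length B \<ge> 2 \<and>
            P = DGP_compose A B)"

definition divisor_set :: "nat \<Rightarrow> nat set" where
  "divisor_set p = {\<Prod>r\<in>prime_factors p. r ^ c r | c :: nat \<Rightarrow> nat.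
                      \<forall>r\<in>prime_factors p. c r \<le> multiplicity r p}"

lemma divisor_set_eq:
  assumes "p > 0"
  shows "divisor_set p = {d. d dvd p}"
proof (intro set_eqI iffI)
  fix d assume "d \<in> divisor_set p"
  then obtain c where d: "d = (\<Prod>r\<in>prime_factors p. r ^ c r)"
    and c: "\<forall>r\<in>prime_factors p. c r \<le> multiplicity r p"
    unfolding divisor_set_def by blast
  have "d dvd (\<Prod>r\<in>prime_factors p. r ^ multiplicity r p)"
    unfolding d using c by (intro prod_dvd_prod) (auto intro: le_imp_power_dvd)
  then show "d \<in> {d. d dvd p}"
    using prime_factorization_nat[OF assms] by simp
next
  fix d assume "d \<in> {d. d dvd p}"
  then have dvd: "d dvd p" by simp
  with assms have d0: "d > 0" by (auto intro: Nat.gr0I)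
  have sub: "prime_factors d \<subseteq> prime_factors p"
    using dvd assms by (intro dvd_prime_factors) auto
  have "d = (\<Prod>r\<in>prime_factors d. r ^ multiplicity r d)"
    using prime_factorization_nat[OF d0] .
  also have "\<dots> = (\<Prod>r\<in>prime_factors p. r ^ multiplicity r d)"
  proof (rule prod.mono_neutral_left[OF _ sub])
    show "finite (prime_factors p)" by simp
  next
    show "\<forall>r\<in>prime_factors p - prime_factors d. r ^ multiplicity r d = 1"
      by (auto simp: prime_factors_multiplicity)
  qed
  finally have "d = (\<Prod>r\<in>prime_factors p. r ^ multiplicity r d)" .
  moreover have "\<forall>r\<in>prime_factors p. multiplicity r d \<le> multiplicity r p"
    using dvd assms by (auto intro: dvd_imp_multiplicity_le)
  ultimately show "d \<in> divisor_set p"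
    unfolding divisor_set_def mem_Collect_eq by (intro exI[of _ "\<lambda>r. multiplicity r d"] conjI)
qed

end

theory Submission
  imports Defs
begin

text \<open>
  A word of the form $RL^qSC$ is automatically shift maximal, since a proper shift that starts
  with $R$ continues with fewer than $q$ letters $L$. Suppose that it equals $O_h * O_s$ and let
  $Q$ be $O_h$ without its final $C$. If $Q$ had a second $R$, then $Q$ would begin with $RL^qR$,
  and the last copy of $Q$ would put a block $L^q$ into $S$. So $Q = RL^{h-2}$, which is odd, and
  $q = h - 1$; a letter $R$ in $O_s$ after the first one would again produce $L^q$ in $S$, so
  $O_s = RL^{s-2}C$. Thus there is exactly one word for every factorization $p = hs$ with
  $h, s \ge 2$, and $h = q + 1$ can be read off it.
\<close>

definition RL_word :: "nat \<Rightarrow> symb list" where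
  "RL_word a = R # replicate a L"

section \<open>The letter order and runs of a single letter\<close>

lemma symb_less_iff [simp]: "L < x \<longleftrightarrow> x \<noteq> L" "x < R \<longleftrightarrow> x \<noteq> R"
  by (cases x; simp add: less_symb_def)+

text \<open>The first letter different from \<open>x\<close> marks where the run ends. This reads
  \<open>q\<close> and \<open>S\<close> off a word RL^qSC; nonemptiness of \<open>u\<close> and
  \<open>v\<close> gives their heads a meaning.\<close>

lemma replicate_append_cancel:
  assumes "replicate m x @ u = replicate n x @ v"
    and "u \<noteq> []" "hd u \<noteq> x" "v \<noteq> []" "hd v \<noteq> x"
  shows "m = n \<and> u = v"
  using assms
proof (induction m arbitrary: n)
  case 0
  then show ?case by (cases n) auto
next
  case (Suc m)
  then show ?case by (cases n) auto
qed

text \<open>No run of \<open>x\<close> can cross the letter \<open>y\<close>. With \<open>y\<close>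
  = R this bounds runs of L in a word block by block.\<close>

lemma sublist_replicate_append_Cons:
  assumes "x \<noteq> y" "sublist (replicate k x) (u @ y # v)"
  shows "sublist (replicate k x) u \<or> sublist (replicate k x) v"
proof -
  from assms(2) consider "sublist (replicate k x) u" | "sublist (replicate k x) (y # v)"
    | xs1 xs2 where "replicate k x = xs1 @ xs2" "suffix xs1 u" "prefix xs2 (y # v)"
    by (auto simp: sublist_append)
  then show ?thesis
  proof cases
    case 2
    then show ?thesis using assms(1) by (cases k) (auto simp: sublist_Cons_right)
  next
    case 3
    have "set xs2 \<subseteq> {x}"
      using arg_cong[OF 3(1), of set] by (auto split: if_splits)
    then have "xs2 = []"
      using 3(3) assms(1) by (cases xs2) auto
    then show ?thesis using 3(1,2) by auto
  qed auto
qed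

lemma sublist_replicate_replicate: "sublist (replicate k x) (replicate n x) \<Longrightarrow> k \<le> n"
  using sublist_length_le by fastforce

section \<open>Shift maximality\<close>

lemma parity_lex_less_first: "x \<noteq> R \<Longrightarrow> parity_lex_less (x # u) (R # v)"
  unfolding parity_lex_less_def by (intro exI[of _ 0]) simp

text \<open>The words first differ right after RL^j, where the second still has L, the least letter.
  That prefix contains one R, so the order is reversed and the longer block wins.\<close>

lemma parity_lex_less_shorter_L_block:
  assumes "j < q" "x \<noteq> L"
  shows "parity_lex_less (R # replicate j L @ x # u) (R # replicate q L @ v)"
proof -
  obtain d where "q = j + Suc d"
    using assms(1) less_iff_Suc_add by auto
  then have q: "replicate q L = replicate j L @ L # replicate d L"
    by (simp only: replicate_add replicate_Suc)
  show ?thesis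
    unfolding parity_lex_less_def using assms(2)
    by (intro exI[of _ "Suc j"]) (simp add: q nth_append count_list_eq_length_filter)
qed

text \<open>Only shifts beginning with R compete with the whole word, so the block to exclude is
  RL^q. Empty \<open>S\<close> covers the factors RL^aC as well.\<close>

lemma MSS_sequence_RL_blocks:
  assumes S: "set S \<subseteq> {R, L}" and no: "\<not> sublist (RL_word q) S"
  shows "MSS_sequence (R # replicate q L @ S @ [C])"
proof -
  let ?P = "R # replicate q L @ S @ [C]"
  have "set (butlast ?P) \<subseteq> {R, L}"
    using S by (auto simp: butlast_append)
  then have "admissible ?P"
    by (auto simp: admissible_def)
  moreover have "parity_lex_less (drop k ?P) ?P" if k: "k < length ?P" "k \<noteq> 0" for k
  proof (cases "?P ! k = R")
    case False
    then show ?thesis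
      using parity_lex_less_first[OF False] Cons_nth_drop_Suc[OF k(1)] by metis
  next
    case True
    \<comment> \<open>Within the initial RL^q the letter R occurs only at index 0, which belongs to
      the trivial shift.\<close>
    have "\<not> k < Suc q"
      using True k by (auto simp: nth_Cons nth_append split: nat.splits)
    then obtain i where i: "k = Suc q + i"
      using le_Suc_ex not_less by blast
    then have drop_eq: "drop k ?P = drop i (S @ [C])" by simp
    have "(S @ [C]) ! i = R"
      using True i by (simp add: nth_append)
    then have iS: "i < length S" "S ! i = R"
      using k i by (auto simp: nth_append split: if_splits)
    define t where "t = drop (Suc i) S"
    define j where "j = length (takeWhile (\<lambda>x. x = L) t)"
    have S_eq: "S = take i S @ R # t"
      using iS id_take_nth_drop t_def by metis
    have t_eq: "t = replicate j L @ dropWhile (\<lambda>x. x = L) t"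
      by (metis (mono_tags) j_def replicate_length_same set_takeWhileD takeWhile_dropWhile_id)
    have "j < q"
    proof (rule ccontr)
      assume "\<not> j < q"
      then have "replicate j L = replicate q L @ replicate (j - q) L"
        by (simp flip: replicate_add)
      with S_eq t_eq have "S = take i S @ RL_word q @ replicate (j - q) L @ dropWhile (\<lambda>x. x = L) t"
        by (simp add: RL_word_def)
      with no show False by (metis sublist_appendI)
    qed
    \<comment> \<open>If \<open>t\<close> consists of L only, the final C serves as the letter
      \<open>x\<close> that ends the run.\<close>
    obtain x u where xu: "dropWhile (\<lambda>x. x = L) t @ [C] = x # u" "x \<noteq> L"
      by (cases "dropWhile (\<lambda>x. x = L) t") (auto dest: dropWhile_eq_Cons_conv[THEN iffD1])
    have "drop i (S @ [C]) = R # t @ [C]"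
      using iS t_def by (simp add: Cons_nth_drop_Suc[symmetric])
    also have "t @ [C] = replicate j L @ x # u"
      using t_eq xu(1) by (metis append.assoc)
    finally show ?thesis
      using drop_eq parity_lex_less_shorter_L_block[OF \<open>j < q\<close> xu(2)] by metis
  qed
  ultimately show ?thesis
    unfolding MSS_sequence_def shift_maximal_def by (metis drop0)
qed

lemma MSS_sequence_RL_word: "MSS_sequence (RL_word a @ [C])"
  using MSS_sequence_RL_blocks[of "[]" a] by (simp add: RL_word_def)

lemma S_words_MSS_sequence:
  assumes "q \<ge> 1" "S \<in> S_words m (q - 1)"
  shows "MSS_sequence (R # replicate q L @ S @ [C])"
proof (rule MSS_sequence_RL_blocks)
  show "set S \<subseteq> {R, L}" using assms by (simp add: S_words_def)
  show "\<not> sublist (RL_word q) S"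
  proof
    assume "sublist (RL_word q) S"
    moreover have "sublist (replicate q L) (RL_word q)"
      by (simp add: RL_word_def sublist_Cons_right)
    ultimately have "sublist (replicate q L) S"
      by (rule sublist_order.order_trans[rotated])
    \<comment> \<open>This is contradictory only because q is positive: subtraction on
      \<open>nat\<close> truncates at 0.\<close>
    with assms have "q \<le> q - 1"
      unfolding S_words_def by blast
    with assms(1) show False by simp
  qed
qed

text \<open>The last proper shift is the one-letter word C. Since it must be smaller than
  \<open>A\<close>, the first letter of \<open>A\<close> exceeds C.\<close>

lemma MSS_sequence_Cons:
  assumes "MSS_sequence A" "length A \<ge> 2"
  obtains w where "A = R # w @ [C]" "set w \<subseteq> {R, L}"
proof -
  from assms(1) have adm: "A \<noteq> []" "set (butlast A) \<subseteq> {R, L}" "last A = C"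
    and max: "shift_maximal A"
    by (auto simp: MSS_sequence_def admissible_def)
  then obtain v where v: "A = v @ [C]"
    by (metis append_butlast_last_id)
  with assms(2) obtain x w where w: "v = x # w"
    by (cases v) auto
  have "drop (length v) A = [C]" "length v < length A"
    using v by simp_all
  with max have "[C] = A \<or> parity_lex_less [C] A"
    unfolding shift_maximal_def by metis
  then have "C < x"
    using v w by (auto simp: parity_lex_less_def)
  then have "x = R"
    by (cases x) (auto simp: less_symb_def)
  with v w adm(2) show ?thesis
    by (intro that[of w]) (auto simp: butlast_append)
qed

section \<open>The products of RL^aC and RL^bC\<close>

definition tail_word :: "nat \<Rightarrow> nat \<Rightarrow> symb list" where
  "tail_word a b = concat (replicate b (RL_word a @ [R])) @ RL_word a"

text \<open>The left factor RL^aC is odd, so the letters of RL^bC are barred: its R becomes an L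
  that lengthens the first block to \<open>Suc a\<close>, and its b letters L become the separating
  R in \<open>tail_word\<close>.\<close>

definition RL_product :: "nat \<Rightarrow> nat \<Rightarrow> symb list" where
  "RL_product a b = R # replicate (Suc a) L @ tail_word a b @ [C]"

lemma tail_word_Suc: "tail_word a (Suc b) = RL_word a @ R # tail_word a b"
  by (simp add: tail_word_def)

lemma tail_word_simps [simp]: "tail_word a b \<noteq> []" "hd (tail_word a b) = R"
  by (induction b) (auto simp: tail_word_Suc tail_word_def[of a 0] RL_word_def)

lemma set_tail_word: "set (tail_word a b) \<subseteq> {R, L}"
  by (auto simp: tail_word_def RL_word_def)

lemma length_RL_product: "length (RL_product a b) = (a + 2) * (b + 2)"
proof -
  have "length (tail_word a b) = b * (a + 2) + a + 1"
    by (induction b) (simp_all add: tail_word_Suc tail_word_def[of a 0] RL_word_def)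
  then show ?thesis by (simp add: RL_product_def algebra_simps)
qed

lemma sublist_L_RL_word: "sublist (replicate k L) (RL_word a) \<Longrightarrow> k \<le> a"
  using sublist_replicate_append_Cons[of L R k "[]" "replicate a L"] sublist_replicate_replicate
  by (fastforce simp: RL_word_def)

lemma sublist_L_tail_word: "sublist (replicate k L) (tail_word a b) \<Longrightarrow> k \<le> a"
proof (induction b)
  case 0
  then show ?case by (simp add: tail_word_def sublist_L_RL_word)
next
  case (Suc b)
  then show ?case
    using sublist_replicate_append_Cons[of L R k] sublist_L_RL_word
    by (metis tail_word_Suc symb.distinct(3))
qed

lemma tail_word_S_words: "tail_word a b \<in> S_words (length (tail_word a b)) a"
  using set_tail_word[of a b] by (auto simp: S_words_def dest: sublist_L_tail_word)

lemma DGP_compose_RL_word_left: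
  "DGP_compose (RL_word a @ [C]) (R # Y @ [C])
   = R # replicate (Suc a) L @ concat (map (\<lambda>y. RL_word a @ [symb_bar y]) Y) @ RL_word a @ [C]"
  by (simp add: DGP_compose_def RL_word_def Let_def count_list_eq_length_filter butlast_append
      replicate_app_Cons_same)

lemma DGP_compose_RL_words:
  "DGP_compose (RL_word a @ [C]) (RL_word b @ [C]) = RL_product a b"
  using DGP_compose_RL_word_left[of a "replicate b L"]
  by (simp add: RL_word_def[of b] RL_product_def tail_word_def map_replicate)

lemma non_primary_RL_product: "non_primary (RL_product a b)"
proof -
  have "MSS_sequence (RL_product a b)"
    unfolding RL_product_def by (rule S_words_MSS_sequence) (use tail_word_S_words in auto)
  moreover have "length (RL_word a @ [C]) \<ge> 2" "length (RL_word b @ [C]) \<ge> 2"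
    by (simp_all add: RL_word_def)
  ultimately show ?thesis
    unfolding non_primary_def using DGP_compose_RL_words MSS_sequence_RL_word by metis
qed

section \<open>Recovering both factors from the shape RL^qSC\<close>

lemma DGP_compose_eq_RL_product:
  assumes A: "MSS_sequence A" "length A \<ge> 2" and B: "MSS_sequence B" "length B \<ge> 2"
    and q: "q \<ge> 1" and S: "S \<in> S_words m (q - 1)"
    and eq: "DGP_compose A B = R # replicate q L @ S @ [C]"
  shows "\<exists>a b. DGP_compose A B = RL_product a b"
proof -
  obtain w where w: "A = R # w @ [C]" "set w \<subseteq> {R, L}"
    using MSS_sequence_Cons[OF A] .
  obtain Y where Y: "B = R # Y @ [C]" "set Y \<subseteq> {R, L}"
    using MSS_sequence_Cons[OF B] .
  have noL: False if "S = u @ replicate q L @ v" for u v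
  proof -
    have "sublist (replicate q L) S" using that by simp
    with S have "q \<le> q - 1" unfolding S_words_def by blast
    with q show False by simp
  qed
  \<comment> \<open>The final C is kept because \<open>S\<close> may be empty; either way the run of
    L after the leading R has length exactly q.\<close>
  have hdS: "S @ [C] \<noteq> []" "hd (S @ [C]) \<noteq> L"
    using S by (auto simp: S_words_def hd_append)
  \<comment> \<open>The parity of \<open>A\<close> is still unknown, so the letter map stays open
    until \<open>w\<close> is seen to consist of L only.\<close>
  define f where "f = (if even (count_list A R) then id else symb_bar)"
  have comp: "DGP_compose A B =
      R # w @ f R # concat (map (\<lambda>y. (R # w) @ [f y]) Y) @ R # w @ [C]"
    by (simp add: DGP_compose_def Let_def f_def w(1) Y(1) butlast_append)
  have "R \<notin> set w"
  proof
    assume "R \<in> set w"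
    then obtain u v where uv: "w = u @ R # v" "R \<notin> set u"
      by (meson split_list_first)
    then have "\<forall>x\<in>set u. x = L" using w(2) by auto
    then have u: "u = replicate (length u) L"
      by (simp add: replicate_length_same)
    let ?z = "R # v @ f R # concat (map (\<lambda>y. (R # w) @ [f y]) Y) @ R # w"
    have "replicate (length u) L @ ?z @ [C] = replicate q L @ S @ [C]"
      using comp eq uv(1) u by simp
    from replicate_append_cancel[OF this _ _ hdS] have "length u = q" "?z = S"
      by auto
    \<comment> \<open>The last copy of Q = \<open>R # w\<close> lies inside \<open>S\<close> and
      again begins with RL^q.\<close>
    moreover have "?z = (R # v @ f R # concat (map (\<lambda>y. (R # w) @ [f y]) Y) @ [R])
        @ replicate (length u) L @ R # v"
      using uv(1) u by simp
    ultimately show False using noL by metis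
  qed
  then have "\<forall>x\<in>set w. x = L" using w(2) by auto
  then obtain a where a: "w = replicate a L"
    by (metis replicate_length_same)
  let ?g = "\<lambda>y. RL_word a @ [symb_bar y]"
  have comp': "DGP_compose A B = R # replicate (Suc a) L @ (concat (map ?g Y) @ RL_word a) @ [C]"
    using DGP_compose_RL_word_left[of a Y] w(1) Y(1) a by (simp add: RL_word_def)
  then have "replicate (Suc a) L @ (concat (map ?g Y) @ RL_word a) @ [C]
      = replicate q L @ S @ [C]"
    using eq by simp
  from replicate_append_cancel[OF this _ _ hdS]
  have qa: "q = Suc a" and S_eq: "S = concat (map ?g Y) @ RL_word a"
    by (cases Y; auto simp: RL_word_def)+
  have "R \<notin> set Y"
  proof
    assume "R \<in> set Y"
    then obtain Y1 Y2 where "Y = Y1 @ R # Y2" by (meson split_list)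
    \<comment> \<open>The barred R is an L appended to RL^a, which completes a run of
      \<open>Suc a\<close> = q letters L inside \<open>S\<close>.\<close>
    then have "S = (concat (map ?g Y1) @ [R]) @ replicate q L @ concat (map ?g Y2) @ RL_word a"
      unfolding S_eq qa by (simp add: RL_word_def replicate_app_Cons_same)
    then show False by (rule noL)
  qed
  then have "\<forall>y\<in>set Y. y = L" using Y(2) by auto
  then have "Y = replicate (length Y) L"
    by (simp add: replicate_length_same)
  then have "A = RL_word a @ [C]" "B = RL_word (length Y) @ [C]"
    using w(1) a Y(1) by (simp_all add: RL_word_def)
  then show ?thesis using DGP_compose_RL_words by metis
qed

text \<open>The run of L after the leading R has length \<open>Suc a\<close>, as
  \<open>tail_word\<close> starts with R. For a fixed length p this also determines
  \<open>b\<close>.\<close>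

lemma RL_product_inject: "RL_product a b = RL_product a' b' \<Longrightarrow> a = a'"
  using replicate_append_cancel[of "Suc a" L "tail_word a b @ [C]" "Suc a'" "tail_word a' b' @ [C]"]
  by (simp add: RL_product_def)

section \<open>Counting by divisors\<close>

lemma non_primary_RL_form_iff:
  "(non_primary P \<and> length P = p \<and>
     (\<exists>q m S. q \<ge> 1 \<and> q + m + 2 = p \<and> S \<in> S_words m (q - 1) \<and>
              P = [R] @ replicate q L @ S @ [C]))
   \<longleftrightarrow> (\<exists>a b. P = RL_product a b \<and> (a + 2) * (b + 2) = p)" (is "?l \<longleftrightarrow> ?r")
proof
  assume ?l
  then show ?r
    using DGP_compose_eq_RL_product length_RL_product unfolding non_primary_def
    by (metis append_Cons append_Nil)
next
  assume ?r
  then obtain a b where P: "P = RL_product a b" and p: "(a + 2) * (b + 2) = p" by blast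
  have "length P = p" using P p length_RL_product by simp
  moreover from this have "Suc a + length (tail_word a b) + 2 = p"
    by (simp add: P RL_product_def)
  moreover have "P = [R] @ replicate (Suc a) L @ tail_word a b @ [C]"
    by (simp add: P RL_product_def)
  moreover have "tail_word a b \<in> S_words (length (tail_word a b)) (Suc a - 1)"
    using tail_word_S_words by simp
  moreover have "non_primary P" using non_primary_RL_product P by simp
  ultimately show ?l
    by (intro conjI exI[of _ "Suc a"] exI[of _ "length (tail_word a b)"] exI[of _ "tail_word a b"]) simp_all
qed

theorem mainTheorem4:
  fixes p :: nat
  assumes "p \<ge> 2"
  shows "int (card {P. non_primary P \<and> length P = p \<and>
                       (\<exists>q m S. q \<ge> 1 \<and> q + m + 2 = p \<and> S \<in> S_words m (q - 1) \<and>
                                P = [R] @ replicate q L @ S @ [C])})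
         = int (card (divisor_set p)) - 2"
proof -
  \<comment> \<open>Here \<open>h\<close> is the length of the left factor and
    \<open>p div h\<close> that of the right one. Removing 1 and p from the divisors makes both at
    least 2, so neither subtraction truncates.\<close>
  let ?W = "\<lambda>h. RL_product (h - 2) (p div h - 2)"
  let ?D = "{h. h dvd p} - {1, p}"
  have "{P. \<exists>a b. P = RL_product a b \<and> (a + 2) * (b + 2) = p} = ?W ` ?D" (is "?X = _")
  proof (intro set_eqI iffI)
    fix P assume "P \<in> ?X"
    then obtain a b where P: "P = RL_product a b" and p: "p = (a + 2) * (b + 2)" by blast
    have "p div (a + 2) = b + 2" unfolding p by (rule nonzero_mult_div_cancel_left) simp
    then have "P = ?W (a + 2)" using P by simp
    moreover have "a + 2 dvd p" unfolding p by (rule dvd_triv_left)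
    then have "a + 2 \<in> ?D" using p by simp
    ultimately show "P \<in> ?W ` ?D" by blast
  next
    fix P assume "P \<in> ?W ` ?D"
    then obtain h where h: "h dvd p" "h \<noteq> 1" "h \<noteq> p" and P: "P = ?W h" by blast
    then obtain s where s: "p = h * s" by auto
    with assms h have "h \<noteq> 0" "s \<noteq> 0" "s \<noteq> 1" by (auto intro: Nat.gr0I)
    then have "h \<ge> 2" "s \<ge> 2" "p div h = s" using h(2) s by auto
    then have "P = RL_product (h - 2) (s - 2)" "(h - 2 + 2) * (s - 2 + 2) = p"
      using P s by (simp_all only: le_add_diff_inverse2)
    then show "P \<in> ?X" by blast
  qed
  moreover have "inj_on ?W ?D"
  proof (rule inj_onI)
    fix h h' assume "h \<in> ?D" "h' \<in> ?D" "?W h = ?W h'"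
    moreover from this have "h \<noteq> 0" "h' \<noteq> 0" using assms by auto
    ultimately show "h = h'" using RL_product_inject[of "h - 2" _ "h' - 2"] by force
  qed
  ultimately have "card ?X = card ?D"
    by (simp add: card_image)
  also have "card ?D = card (divisor_set p) - 2"
    using assms by (subst card_Diff_subset) (auto simp: divisor_set_eq)
  finally have "card ?X = card (divisor_set p) - 2" .
  \<comment> \<open>The divisors 1 and p are distinct, so the subtraction of 2 on \<open>nat\<close>
    does not truncate and carries over to \<open>int\<close>.\<close>
  moreover have "card {1, p} \<le> card (divisor_set p)"
    using assms by (intro card_mono) (auto simp: divisor_set_eq)
  ultimately show ?thesis
    using assms unfolding non_primary_RL_form_iff by simp
qed

end
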